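(* Let $\beta,\gamma,x$ be real parameters and let $\mathfrak{F}$ be the Fock space representation of $\mathfrak{alt}$ with vacuum $\Omega$ described in the context. The generating function for the canonical Appell system $|jk\rangle=Y_1^jX_1^k\Omega$ ($j,k\ge0$) is $$e^{v_1Y_1+v_2X_1}\Omega=\exp\!\Bigl(\frac{y_1v_1}{(1+\beta v_2)^2}\Bigr)\exp\!\Bigl(\frac{y_2v_2}{1+\beta v_2}\Bigr)\exp\!\Bigl(-\frac{2\gamma\beta v_1}{1+\beta v_2}\Bigr)(1+\beta v_2)^{-2x}\,\Omega$$ (as an identity of formal power series in $v_1,v_2$), where one identifies $\bar Y_1\Omega=y_1\cdot1$ and $\bar X_1\Omega=y_2\cdot 1$ in the realization of $\mathfrak{F}$ as functions of $y_1,y_2$, with $$\bar Y_1=e^{\beta X_{-1}}Y_1e^{-\beta X_{-1}}=Y_1-2\beta Y_0+\beta^2Y_{-1},\qquad \bar X_1=e^{\beta X_{-1}}X_1e^{-\beta X_{-1}}=X_1-2\beta X_0+\beta^2X_{-1}.$$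
   Context: $\mathfrak{alt}$ is the six-dimensional real Lie algebra with basis $Y_1,X_1,Y_0,X_0,Y_{-1},X_{-1}$ and brackets, for $n,m\in\{-1,0,1\}$, $$[X_n,X_m]=(n-m)X_{n+m},\quad [X_n,Y_m]=(n-m)Y_{n+m},\quad [Y_n,Y_m]=0.$$ The Fock space $\mathfrak{F}$ is the representation of $\mathfrak{alt}$ with basis $|jk\rangle=Y_1^jX_1^k\Omega$, $j,k\ge0$, generated by a vacuum vector $\Omega=|00\rangle$ satisfying $$Y_{-1}\Omega=0,\quad X_{-1}\Omega=0,\quad Y_0\Omega=-\gamma\,\Omega,\quad X_0\Omega=-x\,\Omega;$$ $Y_1,X_1$ act as raising operators. (Equivalently, it is the module induced from the one-dimensional representation of $\mathrm{span}\{Y_0,X_0,Y_{-1},X_{-1}\}$ given by these formulas.) The operators $\bar Y_1,\bar X_1$ commute. In the realization as functions of $y_1,y_2$, the vacuum $\Omega$ corresponds to the constant function $1$ and $\bar Y_1,\bar X_1$ act as multiplication by $y_1,y_2$, so that $\bar Y_1^{j}\bar X_1^{k}\Omega$ corresponds to $y_1^jy_2^k$. *)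

theory Defs
  imports
    "HOL-Analysis.Linear_Algebra"
    "HOL-Computational_Algebra.Formal_Power_Series"
    "HOL-Library.Groups_Big_Fun"
begin

section \<open>The Lie algebra and its representations\<close>

locale real_lie_algebra =
  fixes bracket :: "'g::real_vector \<Rightarrow> 'g \<Rightarrow> 'g"
  assumes bilinear_bracket: "bilinear bracket"
    and bracket_self: "bracket a a = 0"
    and jacobi: "bracket a (bracket b c) + bracket b (bracket c a) + bracket c (bracket a b) = 0"

(* Only the values of X and Y at -1, 0, 1 matter. If i, j are in {-1,0,1} and i + j is not,
   then i = j and the structure constant i - j vanishes. *)
locale alt_lie_algebra = real_lie_algebra bracket
  for bracket :: "'g::real_vector \<Rightarrow> 'g \<Rightarrow> 'g" +
  fixes X Y :: "int \<Rightarrow> 'g"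
  assumes card_basis: "card (X ` {-1, 0, 1} \<union> Y ` {-1, 0, 1}) = 6"
    and independent_basis: "independent (X ` {-1, 0, 1} \<union> Y ` {-1, 0, 1})"
    and span_basis: "span (X ` {-1, 0, 1} \<union> Y ` {-1, 0, 1}) = UNIV"
    and bracket_XX: "i \<in> {-1, 0, 1} \<Longrightarrow> j \<in> {-1, 0, 1} \<Longrightarrow>
      bracket (X i) (X j) = real_of_int (i - j) *\<^sub>R X (i + j)"
    and bracket_XY: "i \<in> {-1, 0, 1} \<Longrightarrow> j \<in> {-1, 0, 1} \<Longrightarrow>
      bracket (X i) (Y j) = real_of_int (i - j) *\<^sub>R Y (i + j)"
    and bracket_YY: "i \<in> {-1, 0, 1} \<Longrightarrow> j \<in> {-1, 0, 1} \<Longrightarrow> bracket (Y i) (Y j) = 0"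

locale real_lie_representation = real_lie_algebra bracket
  for bracket :: "'g::real_vector \<Rightarrow> 'g \<Rightarrow> 'g" +
  fixes \<rho> :: "'g \<Rightarrow> 'v::real_vector \<Rightarrow> 'v"
  assumes bilinear_rep: "bilinear \<rho>"
    and rep_bracket: "\<rho> (bracket a b) f = \<rho> a (\<rho> b f) - \<rho> b (\<rho> a f)"

section \<open>The Fock space\<close>

definition fock_ket :: "(int \<Rightarrow> 'g) \<Rightarrow> (int \<Rightarrow> 'g) \<Rightarrow> ('g \<Rightarrow> 'v \<Rightarrow> 'v) \<Rightarrow> 'v \<Rightarrow> nat \<Rightarrow> nat \<Rightarrow> 'v"
  where "fock_ket X Y \<rho> \<Omega> j k = ((\<rho> (Y 1)) ^^ j) (((\<rho> (X 1)) ^^ k) \<Omega>)"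

locale alt_fock_space = alt_lie_algebra bracket X Y + real_lie_representation bracket \<rho>
  for bracket :: "'g::real_vector \<Rightarrow> 'g \<Rightarrow> 'g"
    and X Y :: "int \<Rightarrow> 'g"
    and \<rho> :: "'g \<Rightarrow> 'v::real_vector \<Rightarrow> 'v" +
  fixes \<Omega> :: 'v and \<gamma> x :: real
  assumes inj_ket: "inj (\<lambda>(j, k). fock_ket X Y \<rho> \<Omega> j k)"
    and independent_ket: "independent (range (\<lambda>(j, k). fock_ket X Y \<rho> \<Omega> j k))"
    and span_ket: "span (range (\<lambda>(j, k). fock_ket X Y \<rho> \<Omega> j k)) = UNIV"
    and Y_minus_vacuum: "\<rho> (Y (-1)) \<Omega> = 0"
    and X_minus_vacuum: "\<rho> (X (-1)) \<Omega> = 0"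
    and Y_zero_vacuum: "\<rho> (Y 0) \<Omega> = - \<gamma> *\<^sub>R \<Omega>"
    and X_zero_vacuum: "\<rho> (X 0) \<Omega> = - x *\<^sub>R \<Omega>"

section \<open>The conjugated raising operators\<close>

(* The exponential series of an operator applied to f. It is meaningful for locally nilpotent
   operators, where it has only finitely many nonzero terms (Sum_any is 0 otherwise). X (-1)
   acts on the Fock space in this way, as it lowers the degree j + k of the basis vectors. *)
definition op_exp :: "('v::real_vector \<Rightarrow> 'v) \<Rightarrow> 'v \<Rightarrow> 'v"
  where "op_exp A f = Sum_any (\<lambda>n. (1 / fact n) *\<^sub>R (A ^^ n) f)"

definition Y_bar :: "(int \<Rightarrow> 'g::real_vector) \<Rightarrow> (int \<Rightarrow> 'g) \<Rightarrow> ('g \<Rightarrow> 'v::real_vector \<Rightarrow> 'v) \<Rightarrow> real \<Rightarrow> 'v \<Rightarrow> 'v"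
  where "Y_bar X Y \<rho> \<beta> =
    op_exp (\<rho> (\<beta> *\<^sub>R X (-1))) \<circ> \<rho> (Y 1) \<circ> op_exp (\<rho> (- \<beta> *\<^sub>R X (-1)))"

definition X_bar :: "(int \<Rightarrow> 'g::real_vector) \<Rightarrow> ('g \<Rightarrow> 'v::real_vector \<Rightarrow> 'v) \<Rightarrow> real \<Rightarrow> 'v \<Rightarrow> 'v"
  where "X_bar X \<rho> \<beta> =
    op_exp (\<rho> (\<beta> *\<^sub>R X (-1))) \<circ> \<rho> (X 1) \<circ> op_exp (\<rho> (- \<beta> *\<^sub>R X (-1)))"

(* A realization as functions of (y1, y2): a linear injection R, with R f y1 y2 the value at
   (y1, y2) of the function representing f. The range is forced to be the polynomial functions. *)
definition function_realization ::
    "('v::real_vector \<Rightarrow> 'v) \<Rightarrow> ('v \<Rightarrow> 'v) \<Rightarrow> 'v \<Rightarrow> ('v \<Rightarrow> real \<Rightarrow> real \<Rightarrow> real) \<Rightarrow> bool"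
  where "function_realization A B \<Omega> R \<longleftrightarrow>
    (\<forall>y1 y2. linear (\<lambda>f. R f y1 y2)) \<and> inj R \<and>
    (\<forall>y1 y2. R \<Omega> y1 y2 = 1) \<and>
    (\<forall>f y1 y2. R (A f) y1 y2 = y1 * R f y1 y2) \<and>
    (\<forall>f y1 y2. R (B f) y1 y2 = y2 * R f y1 y2)"

section \<open>Formal power series in two variables\<close>

(* A series in v1, v2 with coefficients in a vector space is given by its coefficients:
   c m n is the coefficient of v1^m v2^n. *)

definition const_series :: "'v::real_vector \<Rightarrow> nat \<Rightarrow> nat \<Rightarrow> 'v"
  where "const_series f m n = (if m = 0 \<and> n = 0 then f else 0)"

(* The operator v1 A + v2 B on such series. *)
definition series_op ::
    "('v::real_vector \<Rightarrow> 'v) \<Rightarrow> ('v \<Rightarrow> 'v) \<Rightarrow> (nat \<Rightarrow> nat \<Rightarrow> 'v) \<Rightarrow> nat \<Rightarrow> nat \<Rightarrow> 'v"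
  where "series_op A B c m n =
    (if m = 0 then 0 else A (c (m - 1) n)) + (if n = 0 then 0 else B (c m (n - 1)))"

(* The series exp (v1 A + v2 B) f. Since v1 A + v2 B raises the total degree in v1, v2 by one,
   at most one summand is nonzero in each coefficient. *)
definition exp_series ::
    "('v::real_vector \<Rightarrow> 'v) \<Rightarrow> ('v \<Rightarrow> 'v) \<Rightarrow> 'v \<Rightarrow> nat \<Rightarrow> nat \<Rightarrow> 'v"
  where "exp_series A B f m n =
    Sum_any (\<lambda>N. (1 / fact N) *\<^sub>R ((series_op A B ^^ N) (const_series f)) m n)"

(* Scalar series in v1, v2 have type real fps fps: v1 is the outer variable fps_X and v2 is
   fps_const fps_X. *)
definition series2 :: "(nat \<Rightarrow> nat \<Rightarrow> real) \<Rightarrow> real fps fps"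
  where "series2 c = Abs_fps (\<lambda>m. Abs_fps (\<lambda>n. c m n))"

abbreviation v1 :: "real fps fps"
  where "v1 \<equiv> fps_X"

abbreviation v2 :: "real fps fps"
  where "v2 \<equiv> fps_const fps_X"

abbreviation const2 :: "real \<Rightarrow> real fps fps"
  where "const2 r \<equiv> fps_const (fps_const r)"

(* The exponential of a series g without constant term. The constant term of every argument
   below is zero, so the terms with N > m + n vanish in the coefficient of v1^m v2^n. The
   library's fps_exp needs coefficients in a field, so it does not apply here. *)
definition exp2 :: "real fps fps \<Rightarrow> real fps fps"
  where "exp2 g = series2 (\<lambda>m n. Sum_any (\<lambda>N. (1 / fact N) * fps_nth (fps_nth (g ^ N) m) n))"

(* The binomial series (1 + b v2)^a with real exponent a. *)
definition binomial_v2 :: "real \<Rightarrow> real \<Rightarrow> real fps fps"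
  where "binomial_v2 b a = fps_const (fps_compose (fps_binomial a) (fps_const b * fps_X))"

(* y1, y2 are the values at which the coefficient functions are taken. *)
definition appell_rhs :: "real \<Rightarrow> real \<Rightarrow> real \<Rightarrow> real \<Rightarrow> real \<Rightarrow> real fps fps"
  where "appell_rhs \<beta> \<gamma> x y1 y2 =
    exp2 (const2 y1 * v1 * inverse ((1 + const2 \<beta> * v2)\<^sup>2)) *
    exp2 (const2 y2 * v2 * inverse (1 + const2 \<beta> * v2)) *
    exp2 (- (const2 (2 * \<gamma> * \<beta>) * v1 * inverse (1 + const2 \<beta> * v2))) *
    binomial_v2 \<beta> (- 2 * x)"

end

(* Write E for the exponential of beta X_{-1}, which is an invertible linear map because X_{-1}
   is locally nilpotent. It fixes the vacuum and conjugates Y_1, X_1 into Y_bar, X_bar. Therefore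
   the vectors E |jk> = Y_bar^j X_bar^k Omega form a basis, and a realization is exactly the linear
   map sending E |jk> to y1^j y2^k.

   The action of Y_bar and X_bar on the kets, expressed by Y_1, Y_0, Y_{-1} and X_1, X_0, X_{-1},
   turns multiplication by y1 and y2 into differential equations for the generating function F
   of the realized kets. With u = 1 + beta v2 they read
     u^2 dF/dv1 = (y1 - 2 gamma beta u) F    and    u^2 dF/dv2 = (y2 - 2 x beta u) F at v1 = 0,
   and the right-hand side of the theorem solves them with the same constant term. *)
theory Submission
  imports Defs
begin

section \<open>Differential equations for formal power series\<close>

text \<open>Coefficient \<open>Suc m\<close> of a solution is fixed by the coefficients up to
  \<open>m\<close>, because the factor \<open>of_nat (Suc m)\<close> cancels. An integral domain is
  general enough for both uses: real series in v2, and series in v1 whose coefficients are series in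
  v2.\<close>

lemma fps_linear_ode_unique:
  fixes f g a :: "'a::idom fps"
  assumes char_0: "\<And>n. of_nat (Suc n) \<noteq> (0::'a)"
    and ode: "fps_deriv f = a * f" "fps_deriv g = a * g"
    and init: "fps_nth f 0 = fps_nth g 0"
  shows "f = g"
proof (rule fps_ext)
  fix n
  show "fps_nth f n = fps_nth g n"
  proof (induction n rule: less_induct)
    case (less n)
    show ?case
    proof (cases n)
      case 0
      then show ?thesis using init by simp
    next
      case (Suc m)
      have "fps_nth (fps_deriv f) m = fps_nth (fps_deriv g) m"
        unfolding ode fps_mult_nth using less Suc by (intro sum.cong) auto
      then have "of_nat (Suc m) * fps_nth f (Suc m) = of_nat (Suc m) * fps_nth g (Suc m)"
        by (simp del: of_nat_Suc)
      then show ?thesis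
        unfolding Suc using char_0 mult_left_cancel by blast
    qed
  qed
qed

text \<open>The power N of the argument is concentrated in v1-degree N, so the sum collapses to N =
  m, whatever the constant term of \<open>p\<close>. The first and third exponentials of the
  right-hand side have this shape.\<close>

lemma fps_nth_exp2_const_mult_v1:
  "fps_nth (exp2 (fps_const p * v1)) m = fps_const (1 / fact m) * p ^ m"
proof (rule fps_ext)
  fix n
  have "fps_nth ((fps_const p * v1) ^ N) m = (if N = m then p ^ N else 0)" for N
    by (simp add: power_mult_distrib fps_X_power_nth)
  then have "(1 / fact N) * fps_nth (fps_nth ((fps_const p * v1) ^ N) m) n =
      (if N = m then fps_nth (p ^ m) n / fact m else 0)" for N
    by simp
  then show "fps_nth (fps_nth (exp2 (fps_const p * v1)) m) n =
      fps_nth (fps_const (1 / fact m) * p ^ m) n"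
    by (simp add: exp2_def series2_def)
qed

lemma fps_deriv_exp2_const_mult_v1:
  "fps_deriv (exp2 (fps_const p * v1)) = fps_const p * exp2 (fps_const p * v1)"
proof (rule fps_ext)
  fix m
  have "of_nat (Suc m) * fps_const (1 / fact (Suc m) :: real) = fps_const (1 / fact m)"
    by (simp add: fps_of_nat [symmetric] field_simps del: of_nat_Suc)
  then have "of_nat (Suc m) * fps_const (1 / fact (Suc m) :: real) * (p * p ^ m) =
      p * (fps_const (1 / fact m) * p ^ m)"
    by (metis mult.left_commute)
  then show "fps_nth (fps_deriv (exp2 (fps_const p * v1))) m =
      fps_nth (fps_const p * exp2 (fps_const p * v1)) m"
    by (simp add: fps_nth_exp2_const_mult_v1 mult.assoc del: of_nat_Suc fact_Suc)
qed

text \<open>An argument free of v1 reduces \<open>exp2\<close> to composition of one-variable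
  series, where the chain rule is available. The zero constant term removes all powers N > n from
  coefficient n.\<close>

lemma exp2_fps_const:
  assumes "fps_nth q 0 = 0"
  shows "exp2 (fps_const q) = fps_const (fps_exp 1 oo q)"
proof (intro fps_ext)
  fix m n
  have z: "fps_nth (q ^ N) n = 0" if "n < N" for N
    using startsby_zero_power_prefix [OF assms] that by blast
  have "Sum_any (\<lambda>N. (1 / fact N) * fps_nth (q ^ N) n) = (\<Sum>N=0..n. fps_nth (q ^ N) n / fact N)"
    by (subst Sum_any.expand_superset [of "{0..n}"])
      (use z in \<open>auto intro: ccontr simp: not_le\<close>)
  then show "fps_nth (fps_nth (exp2 (fps_const q)) m) n =
      fps_nth (fps_nth (fps_const (fps_exp 1 oo q)) m) n"
    by (simp add: exp2_def series2_def fps_compose_nth fps_const_power)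
qed

text \<open>This is the logarithmic derivative of exp(y v / u) u^c with u = 1 + beta v; v / u has
  derivative 1 / u^2. With c = -2x and y = y2 it describes the right-hand side at v1 = 0.\<close>

lemma fps_deriv_exp_binomial:
  fixes \<beta> c y :: real
  defines "u \<equiv> 1 + fps_const \<beta> * fps_X"
  defines "h \<equiv> (fps_exp 1 oo (fps_const y * fps_X * inverse u)) *
    (fps_binomial c oo (fps_const \<beta> * fps_X))"
  shows "fps_deriv h = (fps_const y * inverse u ^ 2 + fps_const (c * \<beta>) * inverse u) * h"
    and "fps_nth h 0 = 1"
proof -
  have u0: "fps_nth u 0 = 1"
    by (simp add: u_def)
  have uu: "u * inverse u = 1"
    using inverse_mult_eq_1' [of u] u0 by simp
  have q: "fps_deriv (fps_const y * fps_X * inverse u) = fps_const y * inverse u ^ 2"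
  proof -
    have "fps_deriv (fps_const y * fps_X * inverse u) =
        fps_const y * (inverse u - fps_X * fps_const \<beta> * inverse u ^ 2)"
      using u0 by (simp add: fps_inverse_deriv) (simp add: u_def algebra_simps)
    \<comment> \<open>The extra factor \<open>u * inverse u\<close> brings both terms over u^2; the
      numerator is then u - beta v = 1.\<close>
    also have "inverse u - fps_X * fps_const \<beta> * inverse u ^ 2 =
        inverse u * (u * inverse u) - fps_X * fps_const \<beta> * inverse u ^ 2"
      by (simp add: uu)
    also have "\<dots> = inverse u ^ 2"
      by (simp add: u_def power2_eq_square algebra_simps)
    finally show ?thesis .
  qed
  have e: "fps_deriv (fps_exp 1 oo (fps_const y * fps_X * inverse u)) =
      fps_const y * inverse u ^ 2 * (fps_exp 1 oo (fps_const y * fps_X * inverse u))"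
  proof -
    have "fps_nth (fps_const y * fps_X * inverse u) 0 = 0"
      by simp
    then show ?thesis
      by (simp only: fps_compose_deriv q fps_exp_deriv) (simp add: mult.commute)
  qed
  have b: "fps_deriv (fps_binomial c oo (fps_const \<beta> * fps_X)) =
      fps_const (c * \<beta>) * inverse u * (fps_binomial c oo (fps_const \<beta> * fps_X))"
  proof -
    have "(1 + fps_X) oo (fps_const \<beta> * fps_X) = u"
      by (simp add: u_def fps_compose_add_distrib)
    then show ?thesis
      by (simp add: fps_compose_deriv fps_binomial_deriv fps_divide_unit fps_compose_mult_distrib
          fps_inverse_compose mult_ac fps_const_mult [symmetric] del: fps_const_mult)
  qed
  show "fps_deriv h = (fps_const y * inverse u ^ 2 + fps_const (c * \<beta>) * inverse u) * h"
    unfolding h_def fps_deriv_mult b e by (simp add: algebra_simps)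
  show "fps_nth h 0 = 1"
    by (simp add: h_def)
qed

text \<open>The equation in v1 leaves the whole coefficient of v1^0, a series in v2, as initial
  value. That series is in turn determined by the second equation and its constant term 1.\<close>

lemma appell_rhs_unique:
  fixes F :: "real fps fps" and \<beta> \<gamma> x y1 y2 :: real
  defines "u \<equiv> 1 + fps_const \<beta> * fps_X"
  assumes F: "fps_const (u\<^sup>2) * fps_deriv F = fps_const (fps_const y1 - fps_const (2 * \<gamma> * \<beta>) * u) * F"
    and F0: "u\<^sup>2 * fps_deriv (fps_nth F 0) =
      (fps_const y2 - fps_const (2 * x * \<beta>) * u) * fps_nth F 0"
    and F00: "fps_nth (fps_nth F 0) 0 = 1"
  shows "F = appell_rhs \<beta> \<gamma> x y1 y2"
proof -
  define h where "h = (fps_exp 1 oo (fps_const y2 * fps_X * inverse u)) *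
    (fps_binomial (- 2 * x) oo (fps_const \<beta> * fps_X))"
  define p where "p = fps_const y1 * inverse u ^ 2"
  define p' where "p' = - (fps_const (2 * \<gamma> * \<beta>) * inverse u)"
  have u0: "fps_nth u 0 = 1"
    by (simp add: u_def)
  have uu: "inverse u * u = 1"
    using inverse_mult_eq_1 [of u] u0 by simp
  have cu: "1 + const2 \<beta> * v2 = fps_const u"
    by (simp add: u_def flip: fps_const_add)
  \<comment> \<open>Two exponents are linear in v1, with coefficients \<open>p\<close> and
    \<open>p'\<close> that depend on v2 only; the two factors free of v1 are collected in
    \<open>h\<close>.\<close>
  have rhs: "appell_rhs \<beta> \<gamma> x y1 y2 = exp2 (fps_const p * v1) * exp2 (fps_const p' * v1) * fps_const h"
  proof -
    have "const2 y1 * v1 * inverse ((1 + const2 \<beta> * v2)\<^sup>2) = fps_const p * v1"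
      unfolding cu by (simp add: p_def fps_const_inverse mult_ac fps_inverse_power)
    moreover have "- (const2 (2 * \<gamma> * \<beta>) * v1 * inverse (1 + const2 \<beta> * v2)) = fps_const p' * v1"
      unfolding cu by (simp add: p'_def fps_const_inverse mult_ac flip: fps_const_neg)
    moreover have "const2 y2 * v2 * inverse (1 + const2 \<beta> * v2) =
        fps_const (fps_const y2 * fps_X * inverse u)"
      unfolding cu by (simp add: fps_const_inverse)
    ultimately show ?thesis
      unfolding appell_rhs_def binomial_v2_def h_def
      by (simp add: exp2_fps_const mult_ac)
  qed
  have "fps_nth F 0 = h"
  proof (rule fps_linear_ode_unique)
    show "of_nat (Suc n) \<noteq> (0 :: real)" for n
      by (simp del: of_nat_Suc)
    \<comment> \<open>Since \<open>u\<close> is a unit, the factor u^2 can be divided out to reach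
      the solved form f' = a f.\<close>
    have "fps_deriv (fps_nth F 0) = (inverse u * u)\<^sup>2 * fps_deriv (fps_nth F 0)"
      by (simp add: uu)
    also have "\<dots> = inverse u ^ 2 * (u\<^sup>2 * fps_deriv (fps_nth F 0))"
      by (simp add: power_mult_distrib mult.assoc)
    also have "\<dots> = (fps_const y2 * inverse u ^ 2 - fps_const (2 * x * \<beta>) * inverse u * (inverse u * u)) *
        fps_nth F 0"
      unfolding F0 by (simp add: algebra_simps power2_eq_square)
    finally show "fps_deriv (fps_nth F 0) =
        (fps_const y2 * inverse u ^ 2 - fps_const (2 * x * \<beta>) * inverse u) * fps_nth F 0"
      by (simp add: uu)
    show "fps_deriv h = (fps_const y2 * inverse u ^ 2 - fps_const (2 * x * \<beta>) * inverse u) * h"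
      unfolding h_def u_def fps_deriv_exp_binomial by (simp flip: fps_const_neg)
    show "fps_nth (fps_nth F 0) 0 = fps_nth h 0"
      unfolding h_def u_def fps_deriv_exp_binomial F00 ..
  qed
  show ?thesis
  proof (rule fps_linear_ode_unique)
    show "of_nat (Suc n) \<noteq> (0 :: real fps)" for n
      by (simp flip: fps_of_nat del: of_nat_Suc)
    have "fps_deriv F = fps_const ((inverse u * u)\<^sup>2) * fps_deriv F"
      by (simp add: uu)
    also have "\<dots> = fps_const (inverse u ^ 2) * (fps_const (u\<^sup>2) * fps_deriv F)"
      by (simp add: power_mult_distrib mult.assoc [symmetric])
    also have "\<dots> = fps_const (inverse u ^ 2 * (fps_const y1 - fps_const (2 * \<gamma> * \<beta>) * u)) * F"
      unfolding F by (simp add: mult.assoc [symmetric])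
    also have "inverse u ^ 2 * (fps_const y1 - fps_const (2 * \<gamma> * \<beta>) * u) =
        fps_const y1 * inverse u ^ 2 - fps_const (2 * \<gamma> * \<beta>) * inverse u * (inverse u * u)"
      by (simp add: algebra_simps power2_eq_square)
    also have "\<dots> = p + p'"
      by (simp add: uu p_def p'_def)
    finally show "fps_deriv F = fps_const (p + p') * F" .
    show "fps_deriv (appell_rhs \<beta> \<gamma> x y1 y2) = fps_const (p + p') * appell_rhs \<beta> \<gamma> x y1 y2"
      unfolding rhs fps_deriv_mult fps_deriv_exp2_const_mult_v1 fps_const_add [symmetric]
      by (simp add: algebra_simps del: fps_const_add)
    show "fps_nth F 0 = fps_nth (appell_rhs \<beta> \<gamma> x y1 y2) 0"
      by (simp add: rhs fps_nth_exp2_const_mult_v1 \<open>fps_nth F 0 = h\<close>)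
  qed
qed

text \<open>The hypotheses are the two relations that come from letting \<open>Y_bar\<close> act on all kets and
  \<open>X_bar\<close> on the kets with \<open>m = 0\<close>; the junk values of \<open>H\<close> at truncated indices have coefficient 0.\<close>
lemma series2_eq_appell_rhs:
  fixes H :: "nat \<Rightarrow> nat \<Rightarrow> real"
  assumes H00: "H 0 0 = 1"
    and Y: "\<And>m n. y1 * H m n = H (Suc m) n + 2 * \<beta> * (\<gamma> * H m n + real n * H (Suc m) (n - 1)) +
      \<beta>\<^sup>2 * (2 * \<gamma> * real n * H m (n - 1) + real n * (real n - 1) * H (Suc m) (n - 2))"
    and X: "\<And>n. y2 * H 0 n = H 0 (Suc n) + 2 * \<beta> * (x + real n) * H 0 n +
      \<beta>\<^sup>2 * (real n * (real n - 1 + 2 * x)) * H 0 (n - 1)"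
  shows "series2 (\<lambda>m n. H m n / (fact m * fact n)) = appell_rhs \<beta> \<gamma> x y1 y2"
proof -
  define u :: "real fps" where "u = 1 + fps_const \<beta> * fps_X"
  \<comment> \<open>In terms of the coefficients \<open>G\<close> of the series, a shift up in
    \<open>H\<close> becomes a derivative, and a factor n with a shift down becomes multiplication
    by v2.\<close>
  define G where "G m n = H m n / (fact m * fact n)" for m n
  have H: "H m n = fact m * fact n * G m n" for m n
    by (simp add: G_def)
  have u_nth: "fps_nth (u * f) n = fps_nth f n + (if n = 0 then 0 else \<beta> * fps_nth f (n - 1))"
    for f n
    by (simp add: u_def distrib_right mult.assoc)
  have u2_nth: "fps_nth (u\<^sup>2 * f) n = fps_nth f n +
      (if n = 0 then 0 else 2 * \<beta> * fps_nth f (n - 1) + (if n = 1 then 0 else \<beta>\<^sup>2 * fps_nth f (n - 2)))"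
    for f n
    unfolding power2_eq_square mult.assoc u_nth by (auto simp: algebra_simps numeral_2_eq_2)
  have of_nat_nth: "fps_nth (of_nat k * f) n = of_nat k * fps_nth f n" for k n and f :: "real fps"
    by (simp flip: fps_of_nat)
  show ?thesis
    unfolding G_def [symmetric]
  proof (rule appell_rhs_unique)
    show "fps_const ((1 + fps_const \<beta> * fps_X)\<^sup>2) * fps_deriv (series2 G) =
        fps_const (fps_const y1 - fps_const (2 * \<gamma> * \<beta>) * (1 + fps_const \<beta> * fps_X)) * series2 G"
      unfolding u_def [symmetric]
    proof (intro fps_ext)
      fix m n
      have "fact m * fact n * (y1 * G m n) = fact m * fact n *
          ((Suc m) * G (Suc m) n + (if n = 0 then 0 else 2 * \<beta> * ((Suc m) * G (Suc m) (n - 1)) +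
            (if n = 1 then 0 else \<beta>\<^sup>2 * ((Suc m) * G (Suc m) (n - 2)))) +
           2 * \<gamma> * \<beta> * (G m n + (if n = 0 then 0 else \<beta> * G m (n - 1))))"
        using Y [of m n] unfolding H
        \<comment> \<open>The cases n = 0, n = 1 and n > 1 differ in how many shifts by v2 reach
          coefficient n.\<close>
        by (cases n; cases "n - 1") (simp_all add: algebra_simps power2_eq_square)
      then show "fps_nth (fps_nth (fps_const (u\<^sup>2) * fps_deriv (series2 G)) m) n =
          fps_nth (fps_nth (fps_const (fps_const y1 - fps_const (2 * \<gamma> * \<beta>) * u) * series2 G) m) n"
        by (simp add: u2_nth u_nth of_nat_nth series2_def left_diff_distrib mult.assoc
            del: of_nat_Suc of_nat_add)
    qed
    show "(1 + fps_const \<beta> * fps_X)\<^sup>2 * fps_deriv (fps_nth (series2 G) 0) =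
        (fps_const y2 - fps_const (2 * x * \<beta>) * (1 + fps_const \<beta> * fps_X)) * fps_nth (series2 G) 0"
      unfolding u_def [symmetric]
    proof (rule fps_ext)
      fix n
      \<comment> \<open>The summands of \<open>X\<close> free of x come from u^2 times the
        derivative, those with x from the term 2 x beta u.\<close>
      have "fact n * (y2 * G 0 n) = fact n *
          ((Suc n) * G 0 (Suc n) + (if n = 0 then 0 else 2 * \<beta> * (n * G 0 n) +
            (if n = 1 then 0 else \<beta>\<^sup>2 * ((n - 1) * G 0 (n - 1)))) +
           2 * x * \<beta> * (G 0 n + (if n = 0 then 0 else \<beta> * G 0 (n - 1))))"
        using X [of n] unfolding H
        by (cases n; cases "n - 1") (simp_all add: algebra_simps power2_eq_square)
      then show "fps_nth (u\<^sup>2 * fps_deriv (fps_nth (series2 G) 0)) n =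
          fps_nth ((fps_const y2 - fps_const (2 * x * \<beta>) * u) * fps_nth (series2 G) 0) n"
        by (cases n; cases "n - 1") (simp_all add: u2_nth u_nth series2_def left_diff_distrib mult.assoc
            del: fps_mult_nth_0 fps_mult_nth_1')
    qed
    show "fps_nth (fps_nth (series2 G) 0) 0 = 1"
      by (simp add: series2_def G_def H00)
  qed
qed

section \<open>Exponentials of locally nilpotent operators\<close>

lemma linear_funpow:
  fixes A :: "'v::real_vector \<Rightarrow> 'v"
  assumes "linear A"
  shows "linear (A ^^ n)"
  by (induction n) (auto simp: linear_ident intro: linear_compose [unfolded o_def] assms)

lemma funpow_eq_0_mono:
  fixes A :: "'v::real_vector \<Rightarrow> 'v"
  assumes "linear A" "(A ^^ n) f = 0" "n \<le> m"
  shows "(A ^^ m) f = 0"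
proof -
  have "(A ^^ m) f = (A ^^ (m - n)) ((A ^^ n) f)"
    using \<open>n \<le> m\<close> by (metis comp_apply funpow_add le_add_diff_inverse2)
  then show ?thesis
    using linear_0 [OF linear_funpow [OF assms(1)]] assms(2) by simp
qed

text \<open>The bound \<open>n\<close> need not be minimal, so several vectors can share one. The
  support is finite, so the default value of \<open>Sum_any\<close> does not intervene.\<close>

lemma op_exp_eq_sum:
  fixes A :: "'v::real_vector \<Rightarrow> 'v"
  assumes "linear A" "(A ^^ n) f = 0"
  shows "op_exp A f = (\<Sum>k<n. (1 / fact k) *\<^sub>R (A ^^ k) f)"
  unfolding op_exp_def
  by (rule Sum_any.expand_superset) (use funpow_eq_0_mono [OF assms] in \<open>auto intro: ccontr simp: not_less\<close>)

definition locally_nilpotent :: "('v::real_vector \<Rightarrow> 'v) \<Rightarrow> bool"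
  where "locally_nilpotent A \<longleftrightarrow> (\<forall>f. \<exists>n. (A ^^ n) f = 0)"

lemma locally_nilpotent_common:
  assumes "linear A" "locally_nilpotent A"
  obtains n where "(A ^^ n) f = 0" "(A ^^ n) g = 0"
proof -
  obtain a b where "(A ^^ a) f = 0" "(A ^^ b) g = 0"
    using assms(2) unfolding locally_nilpotent_def by blast
  then have "(A ^^ max a b) f = 0" "(A ^^ max a b) g = 0"
    by (auto intro: funpow_eq_0_mono [OF assms(1)])
  then show thesis
    by (rule that)
qed

lemma linear_op_exp:
  assumes "linear A" "locally_nilpotent A"
  shows "linear (op_exp A)"
proof (rule linearI)
  note lin = linear_funpow [OF assms(1)]
  fix f g :: 'a and c :: real
  obtain n where n: "(A ^^ n) f = 0" "(A ^^ n) g = 0"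
    using locally_nilpotent_common [OF assms] .
  then have "(A ^^ n) (f + g) = 0" "(A ^^ n) (c *\<^sub>R f) = 0"
    by (simp_all add: linear_add [OF lin] linear_scale [OF lin])
  with n show "op_exp A (f + g) = op_exp A f + op_exp A g" "op_exp A (c *\<^sub>R f) = c *\<^sub>R op_exp A f"
    by (simp_all add: op_exp_eq_sum [OF assms(1), where n = n] linear_add [OF lin] linear_scale [OF lin]
        scaleR_right_distrib sum.distrib scaleR_right.sum mult.commute)
qed

lemma funpow_uminus_linear:
  fixes A :: "'v::real_vector \<Rightarrow> 'v"
  assumes "linear A"
  shows "((\<lambda>f. - A f) ^^ n) f = (- 1) ^ n *\<^sub>R (A ^^ n) f"
  by (induction n) (simp_all add: linear_scale [OF assms])

text \<open>In the Cauchy product of the two exponential series, A^k f receives the coefficient (1 -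
  1)^k / k!, which vanishes unless k = 0.\<close>

lemma op_exp_uminus_inverse:
  assumes "linear A" "locally_nilpotent A"
  shows "op_exp A (op_exp (\<lambda>f. - A f) f) = f"
proof -
  define g :: "nat \<Rightarrow> nat \<Rightarrow> 'a"
    where "g i j = ((1 / fact i) * ((- 1) ^ j / fact j)) *\<^sub>R (A ^^ (i + j)) f" for i j
  obtain n where n: "(A ^^ n) f = 0"
    using assms(2) unfolding locally_nilpotent_def by blast
  have lin': "linear (\<lambda>f. - A f)"
    using assms(1) by (rule linear_compose_neg)
  \<comment> \<open>The bound \<open>Suc n\<close> keeps the term of index 0 in range even if
    \<open>n\<close> is 0.\<close>
  have e': "op_exp (\<lambda>f. - A f) f = (\<Sum>j<Suc n. ((- 1) ^ j / fact j) *\<^sub>R (A ^^ j) f)"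
    by (subst op_exp_eq_sum [OF lin', of "Suc n"])
      (simp_all add: funpow_uminus_linear [OF assms(1)] n linear_0 [OF assms(1)])
  have e: "op_exp A ((A ^^ j) f) = (\<Sum>i<Suc n. (1 / fact i) *\<^sub>R (A ^^ (i + j)) f)" for j
  proof -
    have c: "(A ^^ i) ((A ^^ j) f) = (A ^^ (i + j)) f" for i
      by (simp add: funpow_add)
    have "(A ^^ Suc n) ((A ^^ j) f) = 0"
      unfolding c by (rule funpow_eq_0_mono [OF assms(1) n]) simp
    from op_exp_eq_sum [OF assms(1) this] show ?thesis
      unfolding c .
  qed
  have "op_exp A (op_exp (\<lambda>f. - A f) f) = (\<Sum>j<Suc n. \<Sum>i<Suc n. g i j)"
    unfolding e' linear_sum [OF linear_op_exp [OF assms]] linear_scale [OF linear_op_exp [OF assms]] e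
    by (simp add: g_def scaleR_right.sum mult.commute del: sum.lessThan_Suc)
  also have "\<dots> = (\<Sum>i<Suc n. \<Sum>j<Suc n. g i j)"
    by (rule sum.swap)
  also have "\<dots> = (\<Sum>(i, j)\<in>{..<Suc n} \<times> {..<Suc n}. g i j)"
    by (rule sum.cartesian_product)
  \<comment> \<open>Outside the triangle, i + j exceeds \<open>n\<close>, so the power of
    \<open>A\<close> kills \<open>f\<close>.\<close>
  also have "\<dots> = (\<Sum>(i, j)\<in>{(i, j). i + j < Suc n}. g i j)"
    by (rule sum.mono_neutral_right) (auto simp: g_def intro!: funpow_eq_0_mono [OF assms(1) n])
  also have "\<dots> = (\<Sum>k<Suc n. \<Sum>i\<le>k. g i (k - i))"
    by (rule sum.triangle_reindex)
  also have "\<dots> = (\<Sum>k<Suc n. if k = 0 then f else 0)"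
  proof (intro sum.cong refl)
    fix k
    have "(\<Sum>i\<le>k. g i (k - i)) = (\<Sum>i\<le>k. (1 / fact i) * ((- 1) ^ (k - i) / fact (k - i))) *\<^sub>R (A ^^ k) f"
      by (simp add: g_def scaleR_left.sum)
    also have "(\<Sum>i\<le>k. (1 / fact i) * ((- 1) ^ (k - i) / fact (k - i))) = (1 + (- 1)) ^ k / (fact k :: real)"
      unfolding binomial_ring sum_divide_distrib
      by (intro sum.cong refl) (simp add: binomial_fact field_simps)
    finally show "(\<Sum>i\<le>k. g i (k - i)) = (if k = 0 then f else 0)"
      by simp
  qed
  also have "\<dots> = f"
    by simp
  finally show ?thesis .
qed

text \<open>The terminating form of \<open>Ad (exp A) = exp (ad A)\<close>, with \<open>C = ad A B\<close> and
  \<open>2 D = (ad A)\<^sup>2 B\<close>.\<close>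
lemma op_exp_commute:
  fixes A B C D :: "'v::real_vector \<Rightarrow> 'v"
  assumes A: "linear A" "locally_nilpotent A"
    and lin: "linear B" "linear C" "linear D"
    and AB: "\<And>f. A (B f) = B (A f) + C f"
    and AC: "\<And>f. A (C f) = C (A f) + 2 *\<^sub>R D f"
    and AD: "\<And>f. A (D f) = D (A f)"
  shows "op_exp A (B f) = B (op_exp A f) + C (op_exp A f) + D (op_exp A f)"
proof -
  \<comment> \<open>This is the Leibniz rule for powers of A: the second-order term is (n choose 2)
    (ad A)^2 B = n (n - 1) D, and all higher ones vanish because A and D commute.\<close>
  have pow: "(A ^^ n) (B f) = B ((A ^^ n) f) + real n *\<^sub>R C ((A ^^ (n - 1)) f) +
      (real n * (real n - 1)) *\<^sub>R D ((A ^^ (n - 2)) f)" for n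
  proof (induction n)
    case (Suc n)
    let ?c = "real n * (real n - 1)"
    \<comment> \<open>Where truncated subtraction makes the exponents disagree, the scalar in front
      is 0.\<close>
    have 1: "real n *\<^sub>R C (A ((A ^^ (n - 1)) f)) = real n *\<^sub>R C ((A ^^ n) f)"
      by (cases n) simp_all
    have 2: "real n *\<^sub>R D ((A ^^ (n - 1)) f) = real n *\<^sub>R D ((A ^^ (Suc n - 2)) f)"
      by (cases n) simp_all
    have 3: "?c *\<^sub>R D (A ((A ^^ (n - 2)) f)) = ?c *\<^sub>R D ((A ^^ (Suc n - 2)) f)"
      by (cases n; cases "n - 1") simp_all
    have "(A ^^ Suc n) (B f) = B ((A ^^ Suc n) f) + C ((A ^^ n) f) +
        (real n *\<^sub>R C (A ((A ^^ (n - 1)) f)) + 2 *\<^sub>R (real n *\<^sub>R D ((A ^^ (n - 1)) f))) +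
        ?c *\<^sub>R D (A ((A ^^ (n - 2)) f))"
      by (simp add: Suc.IH AB AC AD linear_add [OF A(1)] linear_scale [OF A(1)]
          scaleR_add_right mult.commute)
    also have "\<dots> = B ((A ^^ Suc n) f) + (1 + real n) *\<^sub>R C ((A ^^ n) f) +
        (2 * real n + ?c) *\<^sub>R D ((A ^^ (Suc n - 2)) f)"
      unfolding 1 2 3 by (simp add: scaleR_add_left)
    also have "2 * real n + ?c = real (Suc n) * (real (Suc n) - 1)"
      by (simp add: algebra_simps)
    finally show ?case
      by simp
  qed simp
  obtain n where n: "(A ^^ n) f = 0" "(A ^^ n) (B f) = 0"
    using locally_nilpotent_common [OF A] .
  have n': "(A ^^ Suc n) f = 0" "(A ^^ Suc (Suc n)) f = 0" "(A ^^ Suc (Suc n)) (B f) = 0"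
    using n linear_0 [OF A(1)] by simp_all
  \<comment> \<open>The sums with C and D lose one and two terms on reindexing, so the same
    exponential is needed at three lengths.\<close>
  let ?s = "\<lambda>n. \<Sum>k<n. (1 / fact k) *\<^sub>R (A ^^ k) f"
  have s: "op_exp A f = ?s n" "op_exp A f = ?s (Suc n)" "op_exp A f = ?s (Suc (Suc n))"
    by (rule op_exp_eq_sum [OF A(1)], fact)+
  have "op_exp A (B f) = (\<Sum>k<Suc (Suc n). (1 / fact k) *\<^sub>R (A ^^ k) (B f))"
    using n' by (intro op_exp_eq_sum A)
  also have "\<dots> = (\<Sum>k<Suc (Suc n). (1 / fact k) *\<^sub>R B ((A ^^ k) f)) +
      (\<Sum>k<Suc (Suc n). (real k / fact k) *\<^sub>R C ((A ^^ (k - 1)) f)) +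
      (\<Sum>k<Suc (Suc n). (real k * (real k - 1) / fact k) *\<^sub>R D ((A ^^ (k - 2)) f))"
    unfolding pow by (simp add: scaleR_right_distrib sum.distrib del: sum.lessThan_Suc)
  also have "(\<Sum>k<Suc (Suc n). (1 / fact k) *\<^sub>R B ((A ^^ k) f)) = B (op_exp A f)"
    unfolding s(3) linear_sum [OF lin(1)] linear_scale [OF lin(1)] ..
  also have "(\<Sum>k<Suc (Suc n). (real k / fact k) *\<^sub>R C ((A ^^ (k - 1)) f)) = C (op_exp A f)"
    unfolding s(2) linear_sum [OF lin(2)] linear_scale [OF lin(2)]
    by (subst sum.lessThan_Suc_shift) (simp add: field_simps del: sum.lessThan_Suc of_nat_Suc)
  also have "(\<Sum>k<Suc (Suc n). (real k * (real k - 1) / fact k) *\<^sub>R D ((A ^^ (k - 2)) f)) =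
      D (op_exp A f)"
  proof -
    have "real (Suc (Suc k)) * (real (Suc (Suc k)) - 1) / fact (Suc (Suc k)) = 1 / fact k" for k
    proof -
      define P where "P = real (Suc (Suc k)) * (real (Suc (Suc k)) - 1)"
      have "P \<noteq> 0"
        unfolding P_def by (simp del: of_nat_Suc add: of_nat_Suc [of "Suc k"])
      moreover have "(fact (Suc (Suc k)) :: real) = P * fact k"
        by (simp add: P_def algebra_simps)
      ultimately show ?thesis
        unfolding P_def [symmetric] by (simp del: fact_Suc)
    qed
    then show ?thesis
      unfolding s(1) linear_sum [OF lin(3)] linear_scale [OF lin(3)]
      by (simp add: sum.lessThan_Suc_shift del: sum.lessThan_Suc of_nat_Suc fact_Suc)
  qed
  finally show ?thesis .
qed

section \<open>Polynomial functions and exponential series in two variables\<close>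

text \<open>For fixed y2 this is a polynomial in y1; its coefficients vanish for every y2 and are
  themselves polynomials in y2.\<close>

lemma bivariate_polyfun_eq_0:
  fixes c :: "nat \<Rightarrow> nat \<Rightarrow> real"
  assumes "\<And>y1 y2. (\<Sum>j\<le>n. \<Sum>k\<le>n. c j k * (y1 ^ j * y2 ^ k)) = 0" "j \<le> n" "k \<le> n"
  shows "c j k = 0"
proof -
  have "(\<Sum>j\<le>n. (\<Sum>k\<le>n. c j k * y2 ^ k) * y1 ^ j) = 0" for y1 y2
    using assms(1) [of y1 y2] by (simp add: sum_distrib_left mult_ac)
  then have "(\<Sum>k\<le>n. c j k * y2 ^ k) = 0" for y2
    using polyfun_eq_0 [of "\<lambda>j. \<Sum>k\<le>n. c j k * y2 ^ k" n] \<open>j \<le> n\<close> by blast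
  then show ?thesis
    using polyfun_eq_0 [of "c j" n] \<open>k \<le> n\<close> by blast
qed

text \<open>This is the binomial theorem for the commuting operators v1 A and v2 B; the induction
  step is Pascal's rule.\<close>

lemma series_op_funpow:
  fixes A B :: "'v::real_vector \<Rightarrow> 'v"
  assumes lin: "linear A" "linear B" and comm: "\<And>f. A (B f) = B (A f)"
  shows "(series_op A B ^^ N) (const_series f) m n =
    (if m + n = N then real (N choose m) *\<^sub>R (A ^^ m) ((B ^^ n) f) else 0)"
proof (induction N arbitrary: m n)
  case 0
  show ?case by (simp add: const_series_def)
next
  case (Suc N)
  have B: "B ((A ^^ m) g) = (A ^^ m) (B g)" for m g
    by (induction m) (simp_all flip: comm)
  show ?case
    unfolding funpow.simps comp_apply series_op_def [of A B "(series_op A B ^^ N) (const_series f)"]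
      Suc.IH
    by (cases m; cases n)
      (auto simp: B comm [symmetric] linear_0 [OF lin(1)] linear_0 [OF lin(2)]
        linear_scale [OF lin(1)] linear_scale [OF lin(2)] scaleR_add_left add.commute)
qed

text \<open>Only N = m + n contributes, and (N choose m) / N! = 1 / (m! n!).\<close>

lemma exp_series_eq:
  fixes A B :: "'v::real_vector \<Rightarrow> 'v"
  assumes "linear A" "linear B" "\<And>f. A (B f) = B (A f)"
  shows "exp_series A B f m n = (1 / (fact m * fact n)) *\<^sub>R (A ^^ m) ((B ^^ n) f)"
proof -
  have "(1 / fact N) *\<^sub>R (series_op A B ^^ N) (const_series f) m n =
      (if N = m + n then (1 / (fact m * fact n)) *\<^sub>R (A ^^ m) ((B ^^ n) f) else 0)" for N
    by (simp add: series_op_funpow [OF assms] binomial_fact)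
  then show ?thesis
    by (simp add: exp_series_def)
qed

section \<open>The Fock space\<close>

context alt_fock_space
begin

abbreviation ket :: "nat \<Rightarrow> nat \<Rightarrow> 'v"
  where "ket \<equiv> fock_ket X Y \<rho> \<Omega>"

lemma linear_rep: "linear (\<rho> a)"
  using bilinear_rep by (simp add: bilinear_def)

lemmas rep_add = linear_add [OF linear_rep]
  and rep_scale = linear_scale [OF linear_rep]
  and rep_0 = linear_0 [OF linear_rep]
  and rep_diff = linear_diff [OF linear_rep]
  and rep_neg = linear_neg [OF linear_rep]

lemma rep_scale_left: "\<rho> (c *\<^sub>R a) f = c *\<^sub>R \<rho> a f"
  using bilinear_rep by (rule bilinear_lmul)

lemma rep_commute: "\<rho> a (\<rho> b f) = \<rho> b (\<rho> a f) + \<rho> (bracket a b) f"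
  by (simp add: rep_bracket)

section \<open>Commutation relations and the action of the generators on the kets\<close>

lemma commute_XX:
  assumes "i \<in> {-1, 0, 1}" "j \<in> {-1, 0, 1}"
  shows "\<rho> (X i) (\<rho> (X j) f) = \<rho> (X j) (\<rho> (X i) f) + real_of_int (i - j) *\<^sub>R \<rho> (X (i + j)) f"
  using rep_commute [of "X i" "X j"] by (simp only: bracket_XX [OF assms] rep_scale_left)

lemma commute_XY:
  assumes "i \<in> {-1, 0, 1}" "j \<in> {-1, 0, 1}"
  shows "\<rho> (X i) (\<rho> (Y j) f) = \<rho> (Y j) (\<rho> (X i) f) + real_of_int (i - j) *\<^sub>R \<rho> (Y (i + j)) f"
  using rep_commute [of "X i" "Y j"] by (simp only: bracket_XY [OF assms] rep_scale_left)

lemma commute_YY: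
  assumes "i \<in> {-1, 0, 1}" "j \<in> {-1, 0, 1}"
  shows "\<rho> (Y i) (\<rho> (Y j) f) = \<rho> (Y j) (\<rho> (Y i) f)"
  using rep_commute [of "Y i" "Y j" f] rep_scale_left [of 0 0 f] by (simp add: bracket_YY [OF assms])

lemma ket_0_0: "ket 0 0 = \<Omega>"
  by (simp add: fock_ket_def)

lemma raise_Y: "\<rho> (Y 1) (ket j k) = ket (Suc j) k"
  by (simp add: fock_ket_def)

text \<open>The kets have the powers of Y_1 outermost; X_1 passes through them because [X_1, Y_1] =
  0.\<close>

lemma raise_X: "\<rho> (X 1) (ket j k) = ket j (Suc k)"
proof (induction j)
  case 0
  show ?case by (simp add: fock_ket_def)
next
  case (Suc j)
  have "\<rho> (X 1) (ket (Suc j) k) = \<rho> (Y 1) (\<rho> (X 1) (ket j k))"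
    using commute_XY [of 1 1 "ket j k"] by (simp add: raise_Y)
  then show ?case
    by (simp add: Suc raise_Y)
qed

text \<open>Moving X_0 past any raising operator costs that operator once, so X_0 measures the
  degree. As in the next three lemmas, the operator is moved past Y_1 for k = 0 and then past
  X_1.\<close>

lemma X_zero_ket: "\<rho> (X 0) (ket j k) = - (real j + real k + x) *\<^sub>R ket j k"
proof (induction k)
  case 0
  show ?case
  proof (induction j)
    case 0
    show ?case by (simp add: ket_0_0 X_zero_vacuum)
  next
    case (Suc j)
    show ?case
      using commute_XY [of 0 1 "ket j 0"] by (simp add: raise_Y Suc rep_scale rep_add rep_diff rep_neg algebra_simps)
  qed
next
  case (Suc k)
  show ?case
    using commute_XX [of 0 1 "ket j k"] by (simp add: raise_X Suc rep_scale rep_add rep_diff rep_neg algebra_simps)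
qed

text \<open>Y_0 commutes with Y_1, while [Y_0, X_1] = -Y_1 trades one of the k factors X_1 for a
  Y_1.\<close>

lemma Y_zero_ket: "\<rho> (Y 0) (ket j k) = - \<gamma> *\<^sub>R ket j k - real k *\<^sub>R ket (Suc j) (k - 1)"
proof (induction k)
  case 0
  show ?case
  proof (induction j)
    case 0
    show ?case by (simp add: ket_0_0 Y_zero_vacuum)
  next
    case (Suc j)
    show ?case
      using commute_YY [of 0 1 "ket j 0"] by (simp add: raise_Y Suc rep_scale rep_neg)
  qed
next
  case (Suc k)
  have "\<rho> (Y 0) (ket j (Suc k)) = \<rho> (X 1) (\<rho> (Y 0) (ket j k)) - ket (Suc j) k"
    using commute_XY [of 1 0 "ket j k"] by (simp add: raise_X raise_Y)
  also have "\<rho> (X 1) (\<rho> (Y 0) (ket j k)) = - \<gamma> *\<^sub>R ket j (Suc k) - real k *\<^sub>R ket (Suc j) k"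
    unfolding Suc by (cases k) (simp_all add: rep_diff rep_scale raise_X rep_neg)
  finally show ?case
    by (simp add: algebra_simps)
qed

text \<open>Each passage of Y_{-1} through X_1 leaves -2 Y_0; the coefficients add up the action of
  Y_0 over the k passages.\<close>

lemma Y_minus_ket:
  "\<rho> (Y (-1)) (ket j k) = (2 * \<gamma> * real k) *\<^sub>R ket j (k - 1) +
    (real k * (real k - 1)) *\<^sub>R ket (Suc j) (k - 2)"
proof (induction k)
  case 0
  show ?case
  proof (induction j)
    case 0
    show ?case by (simp add: ket_0_0 Y_minus_vacuum)
  next
    case (Suc j)
    show ?case
      using commute_YY [of "-1" 1 "ket j 0"] by (simp add: raise_Y Suc rep_0)
  qed
next
  case (Suc k)
  have "\<rho> (Y (-1)) (ket j (Suc k)) = \<rho> (X 1) (\<rho> (Y (-1)) (ket j k)) - 2 *\<^sub>R \<rho> (Y 0) (ket j k)"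
    using commute_XY [of 1 "-1" "ket j k"] by (simp add: raise_X)
  also have "\<rho> (X 1) (\<rho> (Y (-1)) (ket j k)) = (2 * \<gamma> * real k) *\<^sub>R ket j k +
      (real k * (real k - 1)) *\<^sub>R ket (Suc j) (k - 1)"
    unfolding Suc by (cases k; cases "k - 1") (simp_all add: rep_add rep_scale raise_X rep_0)
  also have "\<dots> - 2 *\<^sub>R \<rho> (Y 0) (ket j k) = (2 * \<gamma> * real k + 2 * \<gamma>) *\<^sub>R ket j k +
      (real k * (real k - 1) + 2 * real k) *\<^sub>R ket (Suc j) (k - 1)"
    by (simp add: Y_zero_ket scaleR_add_left scaleR_diff_right)
  also have "real k * (real k - 1) + 2 * real k = real (Suc k) * (real (Suc k) - 1)"
    by (simp add: algebra_simps)
  also have "2 * \<gamma> * real k + 2 * \<gamma> = 2 * \<gamma> * real (Suc k)"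
    by (simp add: algebra_simps)
  finally show ?case
    by simp
qed

text \<open>Passing Y_1 leaves -2 Y_0, which contributes 2 gamma each time; passing X_1 leaves -2
  X_0, and its eigenvalues add up to the first coefficient.\<close>

lemma X_minus_ket:
  "\<rho> (X (-1)) (ket j k) = (real k * (2 * real j + real k - 1 + 2 * x)) *\<^sub>R ket j (k - 1) +
    (2 * \<gamma> * real j) *\<^sub>R ket (j - 1) k"
proof (induction k)
  case 0
  show ?case
  proof (induction j)
    case 0
    show ?case by (simp add: ket_0_0 X_minus_vacuum)
  next
    case (Suc j)
    have "\<rho> (X (-1)) (ket (Suc j) 0) = \<rho> (Y 1) (\<rho> (X (-1)) (ket j 0)) - 2 *\<^sub>R \<rho> (Y 0) (ket j 0)"
      using commute_XY [of "-1" 1 "ket j 0"] by (simp add: raise_Y)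
    also have "\<rho> (Y 1) (\<rho> (X (-1)) (ket j 0)) = (2 * \<gamma> * real j) *\<^sub>R ket j 0"
      unfolding Suc by (cases j) (simp_all add: rep_scale raise_Y rep_0)
    finally show ?case
      by (simp add: Y_zero_ket algebra_simps)
  qed
next
  case (Suc k)
  have "\<rho> (X (-1)) (ket j (Suc k)) = \<rho> (X 1) (\<rho> (X (-1)) (ket j k)) - 2 *\<^sub>R \<rho> (X 0) (ket j k)"
    using commute_XX [of "-1" 1 "ket j k"] by (simp add: raise_X)
  also have "\<rho> (X 1) (\<rho> (X (-1)) (ket j k)) =
      (real k * (2 * real j + real k - 1 + 2 * x)) *\<^sub>R ket j k + (2 * \<gamma> * real j) *\<^sub>R ket (j - 1) (Suc k)"
    unfolding Suc by (cases k) (simp_all add: rep_add rep_scale raise_X rep_0)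
  also have "\<dots> - 2 *\<^sub>R \<rho> (X 0) (ket j k) =
      (real k * (2 * real j + real k - 1 + 2 * x) + 2 * (real j + real k + x)) *\<^sub>R ket j k +
      (2 * \<gamma> * real j) *\<^sub>R ket (j - 1) (Suc k)"
    unfolding X_zero_ket scaleR_add_left [of "real k * _"] by (simp flip: scaleR_minus_left)
  also have "real k * (2 * real j + real k - 1 + 2 * x) + 2 * (real j + real k + x) =
      real (Suc k) * (2 * real j + real (Suc k) - 1 + 2 * x)"
    by (simp add: algebra_simps)
  finally show ?case
    by simp
qed

lemma ket_induct [case_names add scale zero ket]:
  assumes "\<And>f g. P f \<Longrightarrow> P g \<Longrightarrow> P (f + g)" "\<And>c f. P f \<Longrightarrow> P (c *\<^sub>R f)" "P 0" "\<And>j k. P (ket j k)"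
  shows "P f"
proof -
  have "f \<in> span (range (\<lambda>(j, k). ket j k))"
    by (simp add: span_ket)
  then show ?thesis
  proof (induction rule: span_induct)
    case base
    show ?case by (rule subspaceI) (use assms in auto)
  qed (use assms in auto)
qed

lemma linear_eq_on_kets:
  assumes "linear S" "linear T" "\<And>j k. S (ket j k) = T (ket j k)"
  shows "S f = T f"
  by (rule linear_eq_on_span [OF assms(1,2), of "range (\<lambda>(j, k). ket j k)"])
    (use assms(3) span_ket in auto)

section \<open>Conjugation by the exponential of X_{-1}\<close>

text \<open>By \<open>X_minus_ket\<close> the degree j + k of a ket drops by one, and the vectors
  killed by some power form a subspace.\<close>

lemma locally_nilpotent_X_minus: "locally_nilpotent (\<rho> (c *\<^sub>R X (-1)))"
  unfolding locally_nilpotent_def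
proof
  fix f
  let ?A = "\<rho> (c *\<^sub>R X (-1))"
  note lin = linear_funpow [OF linear_rep]
  have add: "\<exists>n. (?A ^^ n) (f + g) = 0" if *: "\<exists>n. (?A ^^ n) f = 0" "\<exists>n. (?A ^^ n) g = 0" for f g
  proof -
    obtain m n where "(?A ^^ m) f = 0" "(?A ^^ n) g = 0"
      using * by blast
    then have "(?A ^^ max m n) f = 0" "(?A ^^ max m n) g = 0"
      by (auto intro: funpow_eq_0_mono [OF linear_rep])
    then show ?thesis
      by (intro exI [of _ "max m n"]) (simp add: linear_add [OF lin])
  qed
  have scale: "\<exists>n. (?A ^^ n) (a *\<^sub>R f) = 0" if "\<exists>n. (?A ^^ n) f = 0" for a f
    using that by (auto simp: linear_scale [OF lin])
  have zero: "\<exists>n. (?A ^^ n) 0 = 0"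
    by (rule exI [of _ 0]) simp
  have ket: "\<exists>n. (?A ^^ n) (ket j k) = 0" for j k
  proof (induction "j + k" arbitrary: j k rule: less_induct)
    case less
    \<comment> \<open>For k = 0 the truncated index does not lower the degree, but then the scalar
      is 0.\<close>
    have 1: "\<exists>n. (?A ^^ n) ((real k * (2 * real j + real k - 1 + 2 * x)) *\<^sub>R ket j (k - 1)) = 0"
      using less [of j "k - 1"] scale zero by (cases k) auto
    have 2: "\<exists>n. (?A ^^ n) ((2 * \<gamma> * real j) *\<^sub>R ket (j - 1) k) = 0"
      using less [of "j - 1" k] scale zero by (cases j) auto
    have "?A (ket j k) = c *\<^sub>R ((real k * (2 * real j + real k - 1 + 2 * x)) *\<^sub>R ket j (k - 1) +
        (2 * \<gamma> * real j) *\<^sub>R ket (j - 1) k)"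
      by (simp only: rep_scale_left X_minus_ket)
    then have "\<exists>n. (?A ^^ n) (?A (ket j k)) = 0"
      using scale [OF add [OF 1 2], of c] by (simp only:)
    then obtain n where "(?A ^^ n) (?A (ket j k)) = 0" ..
    then have "(?A ^^ Suc n) (ket j k) = 0"
      by (simp add: funpow_swap1)
    then show ?case ..
  qed
  show "\<exists>n. (?A ^^ n) f = 0"
    by (induction f rule: ket_induct) (fact add scale zero ket)+
qed

abbreviation E :: "real \<Rightarrow> 'v \<Rightarrow> 'v"
  where "E c \<equiv> op_exp (\<rho> (c *\<^sub>R X (-1)))"

lemma linear_E: "linear (E c)"
  by (intro linear_op_exp linear_rep locally_nilpotent_X_minus)

lemma E_inverse: "E c (E (- c) f) = f"
proof -
  have "\<rho> (- c *\<^sub>R X (-1)) = (\<lambda>f. - \<rho> (c *\<^sub>R X (-1)) f)"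
    by (simp add: rep_scale_left fun_eq_iff flip: scaleR_minus_left)
  then show ?thesis
    using op_exp_uminus_inverse [OF linear_rep locally_nilpotent_X_minus] by (simp only:)
qed

lemma E_inverse': "E (- c) (E c f) = f"
  using E_inverse [of "- c"] by simp

lemma E_vacuum: "E c \<Omega> = \<Omega>"
  by (subst op_exp_eq_sum [OF linear_rep, of 1])
    (simp_all add: rep_scale_left X_minus_vacuum)

lemma Y_bar_eq:
  "Y_bar X Y \<rho> \<beta> = (\<lambda>f. \<rho> (Y 1) f - (2 * \<beta>) *\<^sub>R \<rho> (Y 0) f + \<beta>\<^sup>2 *\<^sub>R \<rho> (Y (-1)) f)"
proof
  fix f
  \<comment> \<open>In \<open>op_exp_commute\<close>, A is beta X_{-1}, B is Y_1, C is -2 beta Y_0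
    and D is beta^2 Y_{-1}; the series stops because [X_{-1}, Y_{-1}] = 0.\<close>
  have E_commute: "E \<beta> (\<rho> (Y 1) g) = \<rho> (Y 1) (E \<beta> g) + (- (2 * \<beta>)) *\<^sub>R \<rho> (Y 0) (E \<beta> g) +
      \<beta>\<^sup>2 *\<^sub>R \<rho> (Y (-1)) (E \<beta> g)" for g
    by (intro op_exp_commute linear_rep locally_nilpotent_X_minus linear_compose_scale_right)
      (simp_all add: commute_XY [of "-1" 1] commute_XY [of "-1" 0] commute_XY [of "-1" "-1"]
        rep_scale_left rep_scale rep_neg algebra_simps power2_eq_square)
  show "Y_bar X Y \<rho> \<beta> f = \<rho> (Y 1) f - (2 * \<beta>) *\<^sub>R \<rho> (Y 0) f + \<beta>\<^sup>2 *\<^sub>R \<rho> (Y (-1)) f"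
    unfolding Y_bar_def comp_apply E_commute E_inverse by simp
qed

lemma X_bar_eq:
  "X_bar X \<rho> \<beta> = (\<lambda>f. \<rho> (X 1) f - (2 * \<beta>) *\<^sub>R \<rho> (X 0) f + \<beta>\<^sup>2 *\<^sub>R \<rho> (X (-1)) f)"
proof
  fix f
  have E_commute: "E \<beta> (\<rho> (X 1) g) = \<rho> (X 1) (E \<beta> g) + (- (2 * \<beta>)) *\<^sub>R \<rho> (X 0) (E \<beta> g) +
      \<beta>\<^sup>2 *\<^sub>R \<rho> (X (-1)) (E \<beta> g)" for g
    by (intro op_exp_commute linear_rep locally_nilpotent_X_minus linear_compose_scale_right)
      (simp_all add: commute_XX [of "-1" 1] commute_XX [of "-1" 0]
        rep_scale_left rep_scale rep_neg algebra_simps power2_eq_square)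
  show "X_bar X \<rho> \<beta> f = \<rho> (X 1) f - (2 * \<beta>) *\<^sub>R \<rho> (X 0) f + \<beta>\<^sup>2 *\<^sub>R \<rho> (X (-1)) f"
    unfolding X_bar_def comp_apply E_commute E_inverse by simp
qed

section \<open>Realizations as functions of y1 and y2\<close>

text \<open>\<open>E \<beta>\<close> intertwines Y_1, X_1 with \<open>Y_bar\<close>,
  \<open>X_bar\<close> and fixes the vacuum, so each factor Y_1 or X_1 of the ket becomes a
  multiplication by y1 or y2.\<close>

lemma realization_E_ket:
  assumes "function_realization (Y_bar X Y \<rho> \<beta>) (X_bar X \<rho> \<beta>) \<Omega> R"
  shows "R (E \<beta> (ket j k)) y1 y2 = y1 ^ j * y2 ^ k"
proof (induction j)
  case 0
  show ?case
  proof (induction k)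
    case 0
    show ?case
      using assms by (simp add: ket_0_0 E_vacuum function_realization_def)
  next
    case (Suc k)
    have "E \<beta> (ket 0 (Suc k)) = X_bar X \<rho> \<beta> (E \<beta> (ket 0 k))"
      using E_inverse' [of \<beta>] by (simp add: X_bar_def raise_X del: scaleR_minus_left)
    then show ?case
      using assms Suc by (simp add: function_realization_def)
  qed
next
  case (Suc j)
  have "E \<beta> (ket (Suc j) k) = Y_bar X Y \<rho> \<beta> (E \<beta> (ket j k))"
    using E_inverse' [of \<beta>] by (simp add: Y_bar_def raise_Y del: scaleR_minus_left)
  then show ?case
    using assms Suc by (simp add: function_realization_def)
qed

text \<open>Both realizations agree on the vectors \<open>E \<beta> (ket j k)\<close>, which span
  because \<open>E \<beta>\<close> is onto.\<close>

lemma realization_unique: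
  assumes R: "function_realization (Y_bar X Y \<rho> \<beta>) (X_bar X \<rho> \<beta>) \<Omega> R"
    and R': "function_realization (Y_bar X Y \<rho> \<beta>) (X_bar X \<rho> \<beta>) \<Omega> R'"
  shows "R = R'"
proof (intro ext)
  fix f y1 y2
  have "linear (\<lambda>f. R (E \<beta> f) y1 y2)" "linear (\<lambda>f. R' (E \<beta> f) y1 y2)"
    using R R' linear_compose [OF linear_E, of "\<lambda>f. R f y1 y2" \<beta>]
      linear_compose [OF linear_E, of "\<lambda>f. R' f y1 y2" \<beta>]
    by (auto simp: function_realization_def o_def)
  then have "R (E \<beta> (E (- \<beta>) f)) y1 y2 = R' (E \<beta> (E (- \<beta>) f)) y1 y2"
    by (rule linear_eq_on_kets) (simp add: realization_E_ket [OF R] realization_E_ket [OF R'])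
  then show "R f y1 y2 = R' f y1 y2"
    unfolding E_inverse .
qed

text \<open>Padding with zero coefficients to a full square gives the shape of sum that
  \<open>bivariate_polyfun_eq_0\<close> handles.\<close>

lemma ket_expansion:
  obtains n c where "f = (\<Sum>j\<le>n. \<Sum>k\<le>n. c j k *\<^sub>R ket j k)"
proof -
  let ?K = "\<lambda>(j, k). ket j k"
  obtain T r where T: "finite T" "T \<subseteq> range ?K" "f = (\<Sum>v\<in>T. r v *\<^sub>R v)"
    using span_ket unfolding span_explicit by blast
  define S where "S = ?K -` T"
  have "finite S" "T = ?K ` S"
    using T finite_vimageI [OF T(1) inj_ket] by (auto simp: S_def image_vimage_eq)
  obtain n where n: "S \<subseteq> {..n} \<times> {..n}"
  proof -
    have "finite (fst ` S \<union> snd ` S)"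
      using \<open>finite S\<close> by simp
    then obtain n where "fst ` S \<union> snd ` S \<subseteq> {..n}"
      using finite_nat_iff_bounded_le by blast
    then show thesis
      by (intro that [of n]) force
  qed
  define c where "c j k = (if (j, k) \<in> S then r (ket j k) else 0)" for j k
  have "f = (\<Sum>p\<in>S. r (?K p) *\<^sub>R ?K p)"
    unfolding T(3) \<open>T = ?K ` S\<close>
    by (subst sum.reindex) (auto intro: inj_on_subset [OF inj_ket])
  also have "\<dots> = (\<Sum>(j, k)\<in>{..n} \<times> {..n}. c j k *\<^sub>R ket j k)"
    by (rule sum.mono_neutral_cong_left) (use n in \<open>auto simp: c_def\<close>)
  finally show thesis
    by (intro that [of c n]) (simp add: sum.cartesian_product)
qed

text \<open>The map \<open>M\<close> sending |jk> to y1^j y2^k turns Y_1 and X_1 into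
  multiplications; composing it with \<open>E (- \<beta>)\<close> does the same for
  \<open>Y_bar\<close> and \<open>X_bar\<close>.\<close>

lemma realization_exists:
  "\<exists>R. function_realization (Y_bar X Y \<rho> \<beta>) (X_bar X \<rho> \<beta>) \<Omega> R"
proof -
  have ex: "\<exists>g. linear g \<and> (\<forall>j k. g (ket j k) = y1 ^ j * y2 ^ k)" for y1 y2 :: real
  proof -
    let ?K = "\<lambda>(j, k). ket j k"
    \<comment> \<open>Values may be prescribed freely on the independent kets; \<open>inv\<close>
      recovers the indices because distinct pairs give distinct kets.\<close>
    obtain g where "linear g" and g: "\<And>v. v \<in> range ?K \<Longrightarrow> g v = (\<lambda>(j, k). y1 ^ j * y2 ^ k) (inv ?K v)"
      using linear_independent_extend [OF independent_ket,
          of "\<lambda>v. (\<lambda>(j, k). y1 ^ j * y2 ^ k) (inv ?K v)"]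
      by blast
    have "g (ket j k) = y1 ^ j * y2 ^ k" for j k
      using g [of "?K (j, k)"] inv_f_f [OF inj_ket, of "(j, k)"] by auto
    with \<open>linear g\<close> show ?thesis
      by blast
  qed
  have "\<exists>M. \<forall>y1 y2 :: real. linear (M y1 y2) \<and> (\<forall>j k. M y1 y2 (ket j k) = y1 ^ j * y2 ^ k)"
    by (intro choice allI ex)
  then obtain M where lin: "linear (M y1 y2)" and M: "M y1 y2 (ket j k) = y1 ^ j * y2 ^ k"
    for y1 y2 :: real and j k
    by blast
  \<comment> \<open>Vanishing at one point says little; vanishing at all points makes the
    polynomial, hence every ket coefficient, zero.\<close>
  have inj_M: "f = 0" if 0: "\<And>y1 y2. M y1 y2 f = 0" for f
  proof -
    obtain n c where f: "f = (\<Sum>j\<le>n. \<Sum>k\<le>n. c j k *\<^sub>R ket j k)"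
      by (rule ket_expansion)
    have "(\<Sum>j\<le>n. \<Sum>k\<le>n. c j k * (y1 ^ j * y2 ^ k)) = 0" for y1 y2
      using 0 [of y1 y2] unfolding f by (simp add: linear_sum [OF lin] linear_scale [OF lin] M)
    from bivariate_polyfun_eq_0 [OF this] show ?thesis
      unfolding f by simp
  qed
  have lin_mult: "linear (\<lambda>f. a * M y1 y2 f)" for a y1 y2
    using linear_compose_scale_right [OF lin, of a] by simp
  have M_Y: "M y1 y2 (\<rho> (Y 1) f) = y1 * M y1 y2 f" for y1 y2 f
    by (rule linear_eq_on_kets [of "\<lambda>f. M y1 y2 (\<rho> (Y 1) f)"])
      (auto simp: M raise_Y intro!: lin_mult linear_compose [OF linear_rep lin, unfolded o_def])
  have M_X: "M y1 y2 (\<rho> (X 1) f) = y2 * M y1 y2 f" for y1 y2 f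
    by (rule linear_eq_on_kets [of "\<lambda>f. M y1 y2 (\<rho> (X 1) f)"])
      (auto simp: M raise_X intro!: lin_mult linear_compose [OF linear_rep lin, unfolded o_def])
  have "function_realization (Y_bar X Y \<rho> \<beta>) (X_bar X \<rho> \<beta>) \<Omega> (\<lambda>f y1 y2. M y1 y2 (E (- \<beta>) f))"
    unfolding function_realization_def
  proof (intro conjI allI)
    show "linear (\<lambda>f. M y1 y2 (E (- \<beta>) f))" for y1 y2
      using linear_compose [OF linear_E lin] unfolding o_def .
    show "inj (\<lambda>f y1 y2. M y1 y2 (E (- \<beta>) f))"
    proof (rule injI)
      fix f g assume "(\<lambda>y1 y2. M y1 y2 (E (- \<beta>) f)) = (\<lambda>y1 y2. M y1 y2 (E (- \<beta>) g))"
      then have "M y1 y2 (E (- \<beta>) f - E (- \<beta>) g) = 0" for y1 y2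
        by (simp add: linear_diff [OF lin] fun_eq_iff)
      then have "E (- \<beta>) f = E (- \<beta>) g"
        using inj_M by force
      then show "f = g"
        by (metis E_inverse)
    qed
    show "M y1 y2 (E (- \<beta>) \<Omega>) = 1" for y1 y2
      using M [of y1 y2 0 0] by (simp only: E_vacuum ket_0_0) simp
    show "M y1 y2 (E (- \<beta>) (Y_bar X Y \<rho> \<beta> f)) = y1 * M y1 y2 (E (- \<beta>) f)" for f y1 y2
      by (simp add: Y_bar_def E_inverse' M_Y del: scaleR_minus_left)
    show "M y1 y2 (E (- \<beta>) (X_bar X \<rho> \<beta> f)) = y2 * M y1 y2 (E (- \<beta>) f)" for f y1 y2
      by (simp add: X_bar_def E_inverse' M_X del: scaleR_minus_left)
  qed
  then show ?thesis
    by (intro exI)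
qed

text \<open>Evaluating \<open>R\<close> at a point gives a functional \<open>L\<close>. Computing L
  of \<open>Y_bar\<close> or \<open>X_bar\<close> on a ket both as a multiplication and through the
  generators yields recurrences for the values of L on the kets.\<close>

lemma generating_function:
  assumes "function_realization (Y_bar X Y \<rho> \<beta>) (X_bar X \<rho> \<beta>) \<Omega> R"
  shows "series2 (\<lambda>m n. R (exp_series (\<rho> (Y 1)) (\<rho> (X 1)) \<Omega> m n) y1 y2) = appell_rhs \<beta> \<gamma> x y1 y2"
proof -
  define L where "L f = R f y1 y2" for f
  have lin: "linear L" and L_vacuum: "L \<Omega> = 1"
    and L_Y: "L (Y_bar X Y \<rho> \<beta> f) = y1 * L f" and L_X: "L (X_bar X \<rho> \<beta> f) = y2 * L f" for f
    using assms by (auto simp: function_realization_def L_def [abs_def])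
  note L_simps = linear_add [OF lin] linear_diff [OF lin] linear_scale [OF lin] linear_neg [OF lin]
  have "\<rho> (Y 1) (\<rho> (X 1) f) = \<rho> (X 1) (\<rho> (Y 1) f)" for f
    using commute_XY [of 1 1 f] by simp
  then have "exp_series (\<rho> (Y 1)) (\<rho> (X 1)) \<Omega> m n = (1 / (fact m * fact n)) *\<^sub>R ket m n" for m n
    by (simp add: exp_series_eq linear_rep fock_ket_def)
  then have "(\<lambda>m n. R (exp_series (\<rho> (Y 1)) (\<rho> (X 1)) \<Omega> m n) y1 y2) =
      (\<lambda>m n. L (ket m n) / (fact m * fact n))"
    by (simp add: fun_eq_iff L_def [symmetric] L_simps)
  moreover have "series2 (\<lambda>m n. L (ket m n) / (fact m * fact n)) = appell_rhs \<beta> \<gamma> x y1 y2"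
  proof (rule series2_eq_appell_rhs)
    show "L (ket 0 0) = 1"
      by (simp add: ket_0_0 L_vacuum)
    show "y1 * L (ket m n) = L (ket (Suc m) n) +
        2 * \<beta> * (\<gamma> * L (ket m n) + real n * L (ket (Suc m) (n - 1))) +
        \<beta>\<^sup>2 * (2 * \<gamma> * real n * L (ket m (n - 1)) + real n * (real n - 1) * L (ket (Suc m) (n - 2)))"
      for m n
      unfolding L_Y [symmetric] Y_bar_eq raise_Y Y_zero_ket Y_minus_ket L_simps
      by (simp add: algebra_simps)
    \<comment> \<open>At j = 0 the gamma term of \<open>X_minus_ket\<close> drops out, which leaves
      a recurrence in n alone.\<close>
    show "y2 * L (ket 0 n) = L (ket 0 (Suc n)) + 2 * \<beta> * (x + real n) * L (ket 0 n) +
        \<beta>\<^sup>2 * (real n * (real n - 1 + 2 * x)) * L (ket 0 (n - 1))" for n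
      unfolding L_X [symmetric] X_bar_eq raise_X X_zero_ket X_minus_ket L_simps
      by (simp add: algebra_simps)
  qed
  ultimately show ?thesis
    by simp
qed

end

theorem mainTheorem6:
  fixes bracket :: "'g::real_vector \<Rightarrow> 'g \<Rightarrow> 'g"
    and X Y :: "int \<Rightarrow> 'g"
    and \<rho> :: "'g \<Rightarrow> 'v::real_vector \<Rightarrow> 'v"
    and \<Omega> :: 'v
    and \<beta> \<gamma> x :: real
  assumes "alt_fock_space bracket X Y \<rho> \<Omega> \<gamma> x"
  shows "Y_bar X Y \<rho> \<beta> =
      (\<lambda>f. \<rho> (Y 1) f - (2 * \<beta>) *\<^sub>R \<rho> (Y 0) f + \<beta>\<^sup>2 *\<^sub>R \<rho> (Y (-1)) f) \<and>
    X_bar X \<rho> \<beta> =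
      (\<lambda>f. \<rho> (X 1) f - (2 * \<beta>) *\<^sub>R \<rho> (X 0) f + \<beta>\<^sup>2 *\<^sub>R \<rho> (X (-1)) f) \<and>
    (\<exists>!R. function_realization (Y_bar X Y \<rho> \<beta>) (X_bar X \<rho> \<beta>) \<Omega> R) \<and>
    (\<forall>R. function_realization (Y_bar X Y \<rho> \<beta>) (X_bar X \<rho> \<beta>) \<Omega> R \<longrightarrow>
      (\<forall>y1 y2. series2 (\<lambda>m n. R (exp_series (\<rho> (Y 1)) (\<rho> (X 1)) \<Omega> m n) y1 y2) =
        appell_rhs \<beta> \<gamma> x y1 y2))"
proof -
  interpret alt_fock_space bracket X Y \<rho> \<Omega> \<gamma> x
    by (rule assms)
  show ?thesis
    using Y_bar_eq X_bar_eq realization_exists realization_unique generating_function by blast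
qed

end
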